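(* Let $(X,d)$ be a metric space, let $\mathcal{S}$ be a binary relation on $X$, let $\varrho:[0,\infty)\times[0,\infty)\to\mathbb{R}$ be a function, and let $T:X\to X$ be an ample spectrum contraction w.r.t. $\mathcal{S}$ and $\varrho$. Suppose that $\varrho$ satisfies the following property: whenever $t,s>0$ and $\varrho(t,s)\ge0$, one has $\varrho\left(\frac{t}{r},\frac{s}{r}\right)\ge0$ for all $r>0$. Define $$\theta_{\varrho}:(0,1]\times(0,1]\to\mathbb{R},\qquad \theta_{\varrho}(t,s)=\varrho\left(\frac{1-t}{t},\frac{1-s}{s}\right)\quad\text{for all }t,s\in(0,1].$$ Then $T$ is a fuzzy ample spectrum contraction w.r.t. $(M^{d},\mathcal{S},\theta_{\varrho})$. Furthermore, if property $(\mathcal{B}_5)$ holds, then property $(\mathcal{F}_5)$ (for $(M^d,\mathcal{S},\theta_\varrho)$) also holds; and if property $(\mathcal{B}_2')$ holds, then property $(\mathcal{F}_2')$ (for $(M^d,\mathcal{S},\theta_\varrho)$) also holds.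
   Context: Notation: $\mathbb{I}=[0,1]$, $\mathbb{N}=\{1,2,\ldots\}$, $\mathbb{N}_0=\mathbb{N}\cup\{0\}$. A binary relation on $X$ is a non-empty subset $\mathcal{S}\subseteq X\times X$; $x\mathcal{S}y$ means $(x,y)\in\mathcal{S}$, and $x\mathcal{S}^{\ast}y$ means $x\mathcal{S}y$ and $x\ne y$. A sequence $\{x_n\}$ is $\mathcal{S}$-nondecreasing if $x_n\mathcal{S}x_{n+1}$ for all $n$, and $\mathcal{S}$-strictly-increasing if $x_n\mathcal{S}^{\ast}x_{n+1}$ for all $n$. A Picard sequence of $T$ is a sequence with $x_{n+1}=Tx_n$ for all $n$. Metric notions. Let $A\subseteq\mathbb{R}$ and $\varrho:A\times A\to\mathbb{R}$ (here $A=[0,\infty)$). A sequence of pairs of reals $\{(a_n,b_n)\}$ is a $(T,\mathcal{S}^{\ast})$-sequence if there are sequences $\{x_n\},\{y_n\}\subseteq X$ with $x_n\mathcal{S}^{\ast}y_n$, $Tx_n\mathcal{S}^{\ast}Ty_n$, $a_n=d(Tx_n,Ty_n)$, $b_n=d(x_n,y_n)$ for all $n\in\mathbb{N}_0$. $T$ is an ample spectrum contraction w.r.t. $\mathcal{S}$ and $\varrho$ if: $(\mathcal{B}_1)$ $A$ is nonempty and $\{d(x,y):x,y\in X,\ x\mathcal{S}^{\ast}y\}\subseteq A$. $(\mathcal{B}_2)$ If $\{x_n\}$ is a Picard $\mathcal{S}$-nondecreasing sequence of $T$ such that $x_n\ne x_{n+1}$ and $\varrho(d(x_{n+1},x_{n+2}),d(x_n,x_{n+1}))\ge0$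 for all $n\in\mathbb{N}_0$, then $d(x_n,x_{n+1})\to0$. $(\mathcal{B}_3)$ If $\{(a_n,b_n)\}\subseteq A\times A$ is a $(T,\mathcal{S}^{\ast})$-sequence such that $\{a_n\}$ and $\{b_n\}$ converge to the same limit $L\ge0$ and $L<a_n$ and $\varrho(a_n,b_n)\ge0$ for all $n\in\mathbb{N}_0$, then $L=0$. $(\mathcal{B}_4)$ $\varrho(d(Tx,Ty),d(x,y))\ge0$ for all $x,y\in X$ such that $x\mathcal{S}^{\ast}y$ and $Tx\mathcal{S}^{\ast}Ty$. Auxiliary properties: $(\mathcal{B}_2')$ If $x_1,x_2\in X$ are such that $T^nx_1\mathcal{S}^{\ast}T^nx_2$ and $\varrho(d(T^{n+1}x_1,T^{n+1}x_2),d(T^nx_1,T^nx_2))\ge0$ for all $n\in\mathbb{N}_0$, then $d(T^nx_1,T^nx_2)\to0$. $(\mathcal{B}_5)$ If $\{(a_n,b_n)\}$ is a $(T,\mathcal{S}^{\ast})$-sequence such that $b_n\to0$ and $\varrho(a_n,b_n)\ge0$ for all $n\in\mathbb{N}_0$, then $a_n\to0$. Canonical fuzzy metric. $M^d:X\times X\times[0,\infty)\to\mathbb{I}$, $M^d(x,y,0)=0$ and $M^d(x,y,t)=\dfrac{t}{t+d(x,y)}$ for $t>0$. Fuzzy notions. Let $M:X\times X\times[0,\infty)\to\mathbb{I}$, let $B\subseteq\mathbb{R}^2$ and $\theta:B\to\mathbb{R}$. Put $\mathcal{M}_T=\{(M(Tx,Ty,t),M(x,y,t)):x,y\in X,\ x\mathcal{S}^{\ast}y,\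 Tx\mathcal{S}^{\ast}Ty,\ t>0\}$. A sequence $\{(\phi_n,\psi_n)\}$ of pairs of functions $[0,\infty)\to\mathbb{I}$ is a $(T,\mathcal{S}^{\ast},M)$-sequence if there are $\{x_n\},\{y_n\}\subseteq X$ with $x_n\mathcal{S}^{\ast}y_n$, $Tx_n\mathcal{S}^{\ast}Ty_n$, $\phi_n(t)=M(Tx_n,Ty_n,t)$ and $\psi_n(t)=M(x_n,y_n,t)$ for all $n$ and all $t>0$. $T$ is a fuzzy ample spectrum contraction w.r.t. $(M,\mathcal{S},\theta)$ if: $(\mathcal{F}_1)$ $B$ is nonempty and $\mathcal{M}_T\subseteq B$. $(\mathcal{F}_2)$ If $\{x_n\}$ is a Picard $\mathcal{S}$-strictly-increasing sequence of $T$ such that $\theta(M(x_{n+1},x_{n+2},t),M(x_n,x_{n+1},t))\ge0$ for all $n$ and all $t>0$, then $\lim_{n}M(x_n,x_{n+1},t)=1$ for all $t>0$. $(\mathcal{F}_3)$ If $\{(\phi_n,\psi_n)\}$ is a $(T,\mathcal{S}^{\ast},M)$-sequence and $t_0>0$ are such that $\{\phi_n(t_0)\}$ and $\{\psi_n(t_0)\}$ converge to the same limit $L\in\mathbb{I}$, with $L>\phi_n(t_0)$ and $\theta(\phi_n(t_0),\psi_n(t_0))\ge0$ for all $n$, then $L=1$. $(\mathcal{F}_4)$ $\theta(M(Tx,Ty,t),M(x,y,t))\ge0$ for all $t>0$ and all $x,y\in X$ such that $x\mathcal{S}^{\ast}y$ and $Tx\mathcal{S}^{\ast}Ty$. Auxiliary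 properties: $(\mathcal{F}_2')$ If $\{x_n\},\{y_n\}$ are two Picard sequences of $T$ such that $x_n\mathcal{S}^{\ast}y_n$ and $\theta(M(x_{n+1},y_{n+1},t),M(x_n,y_n,t))\ge0$ for all $n$ and all $t>0$, then $\lim_nM(x_n,y_n,t)=1$ for all $t>0$. $(\mathcal{F}_5)$ If $\{(\phi_n,\psi_n)\}$ is a $(T,\mathcal{S}^{\ast},M)$-sequence such that $\psi_n(t)\to1$ for all $t>0$ and $\theta(\phi_n(t),\psi_n(t))\ge0$ for all $n$ and all $t>0$, then $\phi_n(t)\to1$ for all $t>0$. *)

theory Defs
  imports "HOL-Analysis.Analysis"
begin

text \<open>
  A metric space is given by an explicit carrier \<open>X\<close> and distance \<open>d\<close>. Functions with a restricted
  domain are rendered as total functions together with the set on which they are meant to be used: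
  \<open>A\<close> for \<open>\<rho> : A \<times> A \<rightarrow> \<real>\<close> and \<open>B\<close> for \<open>\<theta> : B \<rightarrow> \<real>\<close>. Under conditions B1 and F1 none of the notions
  below depends on the values of \<open>\<rho>\<close> or \<open>\<theta>\<close> outside these sets. All sequences are indexed from 0.
\<close>

definition binary_relation_on :: "'a set \<Rightarrow> ('a \<times> 'a) set \<Rightarrow> bool" where
  "binary_relation_on X S \<longleftrightarrow> S \<noteq> {} \<and> S \<subseteq> X \<times> X"

definition strict_rel :: "('a \<times> 'a) set \<Rightarrow> ('a \<times> 'a) set" where
  "strict_rel S = {(x, y). (x, y) \<in> S \<and> x \<noteq> y}"

definition rel_nondecreasing :: "('a \<times> 'a) set \<Rightarrow> (nat \<Rightarrow> 'a) \<Rightarrow> bool" where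
  "rel_nondecreasing S x \<longleftrightarrow> (\<forall>n. (x n, x (Suc n)) \<in> S)"

definition rel_strictly_increasing :: "('a \<times> 'a) set \<Rightarrow> (nat \<Rightarrow> 'a) \<Rightarrow> bool" where
  "rel_strictly_increasing S x \<longleftrightarrow> (\<forall>n. (x n, x (Suc n)) \<in> strict_rel S)"

definition picard_sequence :: "'a set \<Rightarrow> ('a \<Rightarrow> 'a) \<Rightarrow> (nat \<Rightarrow> 'a) \<Rightarrow> bool" where
  "picard_sequence X T x \<longleftrightarrow> (\<forall>n. x n \<in> X) \<and> (\<forall>n. x (Suc n) = T (x n))"

definition rel_sequence ::
  "'a set \<Rightarrow> ('a \<Rightarrow> 'a \<Rightarrow> real) \<Rightarrow> ('a \<times> 'a) set \<Rightarrow> ('a \<Rightarrow> 'a) \<Rightarrow>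
    (nat \<Rightarrow> real) \<Rightarrow> (nat \<Rightarrow> real) \<Rightarrow> bool" where
  "rel_sequence X d S T a b \<longleftrightarrow>
    (\<exists>x y. \<forall>n. x n \<in> X \<and> y n \<in> X \<and>
      (x n, y n) \<in> strict_rel S \<and> (T (x n), T (y n)) \<in> strict_rel S \<and>
      a n = d (T (x n)) (T (y n)) \<and> b n = d (x n) (y n))"

definition cond_B1 ::
  "'a set \<Rightarrow> ('a \<Rightarrow> 'a \<Rightarrow> real) \<Rightarrow> ('a \<times> 'a) set \<Rightarrow> real set \<Rightarrow> bool" where
  "cond_B1 X d S A \<longleftrightarrow>
    A \<noteq> {} \<and> {d x y | x y. x \<in> X \<and> y \<in> X \<and> (x, y) \<in> strict_rel S} \<subseteq> A"

definition cond_B2 ::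
  "'a set \<Rightarrow> ('a \<Rightarrow> 'a \<Rightarrow> real) \<Rightarrow> ('a \<times> 'a) set \<Rightarrow> (real \<Rightarrow> real \<Rightarrow> real) \<Rightarrow>
    ('a \<Rightarrow> 'a) \<Rightarrow> bool" where
  "cond_B2 X d S \<rho> T \<longleftrightarrow>
    (\<forall>x. picard_sequence X T x \<and> rel_nondecreasing S x \<and>
      (\<forall>n. x n \<noteq> x (Suc n) \<and>
           \<rho> (d (x (Suc n)) (x (Suc (Suc n)))) (d (x n) (x (Suc n))) \<ge> 0)
      \<longrightarrow> (\<lambda>n. d (x n) (x (Suc n))) \<longlonglongrightarrow> 0)"

definition cond_B3 ::
  "'a set \<Rightarrow> ('a \<Rightarrow> 'a \<Rightarrow> real) \<Rightarrow> ('a \<times> 'a) set \<Rightarrow> real set \<Rightarrow>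
    (real \<Rightarrow> real \<Rightarrow> real) \<Rightarrow> ('a \<Rightarrow> 'a) \<Rightarrow> bool" where
  "cond_B3 X d S A \<rho> T \<longleftrightarrow>
    (\<forall>a b L. (\<forall>n. a n \<in> A \<and> b n \<in> A) \<and> rel_sequence X d S T a b \<and>
      L \<ge> 0 \<and> a \<longlonglongrightarrow> L \<and> b \<longlonglongrightarrow> L \<and> (\<forall>n. L < a n \<and> \<rho> (a n) (b n) \<ge> 0)
      \<longrightarrow> L = 0)"

definition cond_B4 ::
  "'a set \<Rightarrow> ('a \<Rightarrow> 'a \<Rightarrow> real) \<Rightarrow> ('a \<times> 'a) set \<Rightarrow> (real \<Rightarrow> real \<Rightarrow> real) \<Rightarrow>
    ('a \<Rightarrow> 'a) \<Rightarrow> bool" where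
  "cond_B4 X d S \<rho> T \<longleftrightarrow>
    (\<forall>x\<in>X. \<forall>y\<in>X. (x, y) \<in> strict_rel S \<and> (T x, T y) \<in> strict_rel S
      \<longrightarrow> \<rho> (d (T x) (T y)) (d x y) \<ge> 0)"

definition ample_spectrum_contraction ::
  "'a set \<Rightarrow> ('a \<Rightarrow> 'a \<Rightarrow> real) \<Rightarrow> ('a \<times> 'a) set \<Rightarrow> real set \<Rightarrow>
    (real \<Rightarrow> real \<Rightarrow> real) \<Rightarrow> ('a \<Rightarrow> 'a) \<Rightarrow> bool" where
  "ample_spectrum_contraction X d S A \<rho> T \<longleftrightarrow>
    cond_B1 X d S A \<and> cond_B2 X d S \<rho> T \<and> cond_B3 X d S A \<rho> T \<and> cond_B4 X d S \<rho> T"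

definition cond_B2' ::
  "'a set \<Rightarrow> ('a \<Rightarrow> 'a \<Rightarrow> real) \<Rightarrow> ('a \<times> 'a) set \<Rightarrow> (real \<Rightarrow> real \<Rightarrow> real) \<Rightarrow>
    ('a \<Rightarrow> 'a) \<Rightarrow> bool" where
  "cond_B2' X d S \<rho> T \<longleftrightarrow>
    (\<forall>x1\<in>X. \<forall>x2\<in>X.
      (\<forall>n. ((T ^^ n) x1, (T ^^ n) x2) \<in> strict_rel S \<and>
           \<rho> (d ((T ^^ Suc n) x1) ((T ^^ Suc n) x2)) (d ((T ^^ n) x1) ((T ^^ n) x2)) \<ge> 0)
      \<longrightarrow> (\<lambda>n. d ((T ^^ n) x1) ((T ^^ n) x2)) \<longlonglongrightarrow> 0)"

definition cond_B5 ::
  "'a set \<Rightarrow> ('a \<Rightarrow> 'a \<Rightarrow> real) \<Rightarrow> ('a \<times> 'a) set \<Rightarrow> (real \<Rightarrow> real \<Rightarrow> real) \<Rightarrow>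
    ('a \<Rightarrow> 'a) \<Rightarrow> bool" where
  "cond_B5 X d S \<rho> T \<longleftrightarrow>
    (\<forall>a b. rel_sequence X d S T a b \<and> b \<longlonglongrightarrow> 0 \<and> (\<forall>n. \<rho> (a n) (b n) \<ge> 0) \<longrightarrow> a \<longlonglongrightarrow> 0)"

definition fuzzy_pairs ::
  "'a set \<Rightarrow> ('a \<Rightarrow> 'a \<Rightarrow> real \<Rightarrow> real) \<Rightarrow> ('a \<times> 'a) set \<Rightarrow> ('a \<Rightarrow> 'a) \<Rightarrow>
    (real \<times> real) set" where
  "fuzzy_pairs X M S T =
    {(M (T x) (T y) t, M x y t) | x y t. x \<in> X \<and> y \<in> X \<and>
      (x, y) \<in> strict_rel S \<and> (T x, T y) \<in> strict_rel S \<and> t > 0}"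

definition fuzzy_rel_sequence ::
  "'a set \<Rightarrow> ('a \<Rightarrow> 'a \<Rightarrow> real \<Rightarrow> real) \<Rightarrow> ('a \<times> 'a) set \<Rightarrow> ('a \<Rightarrow> 'a) \<Rightarrow>
    (nat \<Rightarrow> real \<Rightarrow> real) \<Rightarrow> (nat \<Rightarrow> real \<Rightarrow> real) \<Rightarrow> bool" where
  "fuzzy_rel_sequence X M S T \<phi> \<psi> \<longleftrightarrow>
    (\<forall>n. \<phi> n \<in> {0..} \<rightarrow> {0..1} \<and> \<psi> n \<in> {0..} \<rightarrow> {0..1}) \<and>
    (\<exists>x y. \<forall>n. x n \<in> X \<and> y n \<in> X \<and>
      (x n, y n) \<in> strict_rel S \<and> (T (x n), T (y n)) \<in> strict_rel S \<and>
      (\<forall>t>0. \<phi> n t = M (T (x n)) (T (y n)) t \<and> \<psi> n t = M (x n) (y n) t))"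

definition cond_F1 ::
  "'a set \<Rightarrow> ('a \<Rightarrow> 'a \<Rightarrow> real \<Rightarrow> real) \<Rightarrow> ('a \<times> 'a) set \<Rightarrow> (real \<times> real) set \<Rightarrow>
    ('a \<Rightarrow> 'a) \<Rightarrow> bool" where
  "cond_F1 X M S B T \<longleftrightarrow> B \<noteq> {} \<and> fuzzy_pairs X M S T \<subseteq> B"

definition cond_F2 ::
  "'a set \<Rightarrow> ('a \<Rightarrow> 'a \<Rightarrow> real \<Rightarrow> real) \<Rightarrow> ('a \<times> 'a) set \<Rightarrow> (real \<Rightarrow> real \<Rightarrow> real) \<Rightarrow>
    ('a \<Rightarrow> 'a) \<Rightarrow> bool" where
  "cond_F2 X M S \<theta> T \<longleftrightarrow>
    (\<forall>x. picard_sequence X T x \<and> rel_strictly_increasing S x \<and>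
      (\<forall>n. \<forall>t>0. \<theta> (M (x (Suc n)) (x (Suc (Suc n))) t) (M (x n) (x (Suc n)) t) \<ge> 0)
      \<longrightarrow> (\<forall>t>0. (\<lambda>n. M (x n) (x (Suc n)) t) \<longlonglongrightarrow> 1))"

definition cond_F3 ::
  "'a set \<Rightarrow> ('a \<Rightarrow> 'a \<Rightarrow> real \<Rightarrow> real) \<Rightarrow> ('a \<times> 'a) set \<Rightarrow> (real \<Rightarrow> real \<Rightarrow> real) \<Rightarrow>
    ('a \<Rightarrow> 'a) \<Rightarrow> bool" where
  "cond_F3 X M S \<theta> T \<longleftrightarrow>
    (\<forall>\<phi> \<psi> t0 L. fuzzy_rel_sequence X M S T \<phi> \<psi> \<and> t0 > 0 \<and> L \<in> {0..1} \<and>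
      (\<lambda>n. \<phi> n t0) \<longlonglongrightarrow> L \<and> (\<lambda>n. \<psi> n t0) \<longlonglongrightarrow> L \<and>
      (\<forall>n. L > \<phi> n t0 \<and> \<theta> (\<phi> n t0) (\<psi> n t0) \<ge> 0)
      \<longrightarrow> L = 1)"

definition cond_F4 ::
  "'a set \<Rightarrow> ('a \<Rightarrow> 'a \<Rightarrow> real \<Rightarrow> real) \<Rightarrow> ('a \<times> 'a) set \<Rightarrow> (real \<Rightarrow> real \<Rightarrow> real) \<Rightarrow>
    ('a \<Rightarrow> 'a) \<Rightarrow> bool" where
  "cond_F4 X M S \<theta> T \<longleftrightarrow>
    (\<forall>t>0. \<forall>x\<in>X. \<forall>y\<in>X. (x, y) \<in> strict_rel S \<and> (T x, T y) \<in> strict_rel S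
      \<longrightarrow> \<theta> (M (T x) (T y) t) (M x y t) \<ge> 0)"

definition fuzzy_ample_spectrum_contraction ::
  "'a set \<Rightarrow> ('a \<Rightarrow> 'a \<Rightarrow> real \<Rightarrow> real) \<Rightarrow> ('a \<times> 'a) set \<Rightarrow> (real \<times> real) set \<Rightarrow>
    (real \<Rightarrow> real \<Rightarrow> real) \<Rightarrow> ('a \<Rightarrow> 'a) \<Rightarrow> bool" where
  "fuzzy_ample_spectrum_contraction X M S B \<theta> T \<longleftrightarrow>
    cond_F1 X M S B T \<and> cond_F2 X M S \<theta> T \<and> cond_F3 X M S \<theta> T \<and> cond_F4 X M S \<theta> T"

definition cond_F2' ::
  "'a set \<Rightarrow> ('a \<Rightarrow> 'a \<Rightarrow> real \<Rightarrow> real) \<Rightarrow> ('a \<times> 'a) set \<Rightarrow> (real \<Rightarrow> real \<Rightarrow> real) \<Rightarrow>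
    ('a \<Rightarrow> 'a) \<Rightarrow> bool" where
  "cond_F2' X M S \<theta> T \<longleftrightarrow>
    (\<forall>x y. picard_sequence X T x \<and> picard_sequence X T y \<and>
      (\<forall>n. (x n, y n) \<in> strict_rel S) \<and>
      (\<forall>n. \<forall>t>0. \<theta> (M (x (Suc n)) (y (Suc n)) t) (M (x n) (y n) t) \<ge> 0)
      \<longrightarrow> (\<forall>t>0. (\<lambda>n. M (x n) (y n) t) \<longlonglongrightarrow> 1))"

definition cond_F5 ::
  "'a set \<Rightarrow> ('a \<Rightarrow> 'a \<Rightarrow> real \<Rightarrow> real) \<Rightarrow> ('a \<times> 'a) set \<Rightarrow> (real \<Rightarrow> real \<Rightarrow> real) \<Rightarrow>
    ('a \<Rightarrow> 'a) \<Rightarrow> bool" where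
  "cond_F5 X M S \<theta> T \<longleftrightarrow>
    (\<forall>\<phi> \<psi>. fuzzy_rel_sequence X M S T \<phi> \<psi> \<and> (\<forall>t>0. (\<lambda>n. \<psi> n t) \<longlonglongrightarrow> 1) \<and>
      (\<forall>n. \<forall>t>0. \<theta> (\<phi> n t) (\<psi> n t) \<ge> 0)
      \<longrightarrow> (\<forall>t>0. (\<lambda>n. \<phi> n t) \<longlonglongrightarrow> 1))"

text \<open>Only arguments \<open>t \<ge> 0\<close> are meaningful; the value 0 for \<open>t < 0\<close> is a dummy.\<close>

definition canonical_fuzzy_metric :: "('a \<Rightarrow> 'a \<Rightarrow> real) \<Rightarrow> 'a \<Rightarrow> 'a \<Rightarrow> real \<Rightarrow> real" where
  "canonical_fuzzy_metric d x y t = (if t > 0 then t / (t + d x y) else 0)"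

lemma (in Metric_space) canonical_fuzzy_metric_in_unit:
  "canonical_fuzzy_metric d x y t \<in> {0..1}"
  by (simp add: canonical_fuzzy_metric_def divide_simps add_pos_nonneg)

text \<open>Meaningful on \<open>(0,1] \<times> (0,1]\<close> only.\<close>

definition theta_of :: "(real \<Rightarrow> real \<Rightarrow> real) \<Rightarrow> real \<Rightarrow> real \<Rightarrow> real" where
  "theta_of \<rho> t s = \<rho> ((1 - t) / t) ((1 - s) / s)"

end

(*
  Everything rests on (1 - M x y t) / M x y t = d x y / t for the canonical fuzzy metric M and t > 0:
  theta evaluated on M-values at level t is rho evaluated on distances divided by t. At t = 1 a
  fuzzy hypothesis is literally the metric one. A single level t0 is all that is given in F3,
  and the scaling property of rho passes from t0 back to level 1 (and, in F4, from level 1 to t).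
*)

theory Submission
  imports Defs
begin

context Metric_space
begin

lemma canonical_fuzzy_metric_pos:
  assumes "t > 0"
  shows "canonical_fuzzy_metric d x y t > 0"
  using assms nonneg[of x y] by (simp add: canonical_fuzzy_metric_def add_pos_nonneg)

text \<open>The map \<open>u \<mapsto> (1 - u) / u\<close> sends \<open>t / (t + r)\<close> to
  \<open>r / t\<close>, because \<open>1 - t / (t + r) = r / (t + r)\<close> and the denominators
  cancel.\<close>

lemma canonical_fuzzy_metric_odds:
  assumes "t > 0"
  shows "(1 - canonical_fuzzy_metric d x y t) / canonical_fuzzy_metric d x y t = d x y / t"
proof -
  have "t + d x y > 0"
    using assms nonneg[of x y] by linarith
  then have "1 - t / (t + d x y) = d x y / (t + d x y)"
    by (simp add: field_simps)
  then show ?thesis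
    using assms \<open>t + d x y > 0\<close> by (simp add: canonical_fuzzy_metric_def)
qed

lemma theta_of_canonical_fuzzy_metric:
  assumes "t > 0"
  shows "theta_of \<rho> (canonical_fuzzy_metric d u v t) (canonical_fuzzy_metric d x y t)
    = \<rho> (d u v / t) (d x y / t)"
  unfolding theta_of_def using canonical_fuzzy_metric_odds[OF assms] by simp

text \<open>The distance is \<open>t\<close> times the odds of the fuzzy value, and the odds are
  continuous away from 0. This is where \<open>L \<noteq> 0\<close> enters.\<close>

lemma tendsto_dist_of_canonical_fuzzy_metric:
  assumes "t > 0" "L \<noteq> 0" "((\<lambda>n. canonical_fuzzy_metric d (x n) (y n) t) \<longlongrightarrow> L) F"
  shows "((\<lambda>n. d (x n) (y n)) \<longlongrightarrow> t * ((1 - L) / L)) F"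
proof -
  have "((\<lambda>n. t * ((1 - canonical_fuzzy_metric d (x n) (y n) t) /
      canonical_fuzzy_metric d (x n) (y n) t)) \<longlongrightarrow> t * ((1 - L) / L)) F"
    by (intro tendsto_intros assms)
  then show ?thesis
    using assms(1) by (simp add: canonical_fuzzy_metric_odds)
qed

text \<open>The right-hand side does not mention \<open>t\<close>, so convergence to 1 at one level
  carries over to every level.\<close>

lemma canonical_fuzzy_metric_tendsto_1_iff:
  assumes "t > 0"
  shows "((\<lambda>n. canonical_fuzzy_metric d (x n) (y n) t) \<longlongrightarrow> 1) F
    \<longleftrightarrow> ((\<lambda>n. d (x n) (y n)) \<longlongrightarrow> 0) F"
proof
  assume "((\<lambda>n. d (x n) (y n)) \<longlongrightarrow> 0) F"
  then have "((\<lambda>n. t / (t + d (x n) (y n))) \<longlongrightarrow> t / (t + 0)) F"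
    using assms by (intro tendsto_intros) auto
  then show "((\<lambda>n. canonical_fuzzy_metric d (x n) (y n) t) \<longlongrightarrow> 1) F"
    using assms by (simp add: canonical_fuzzy_metric_def)
next
  assume "((\<lambda>n. canonical_fuzzy_metric d (x n) (y n) t) \<longlongrightarrow> 1) F"
  from tendsto_dist_of_canonical_fuzzy_metric[OF assms _ this]
  show "((\<lambda>n. d (x n) (y n)) \<longlongrightarrow> 0) F" by simp
qed

text \<open>Supplies the positivity under which the scaling property of \<open>\<rho>\<close> may be
  applied.\<close>

lemma dist_pos_strict_rel:
  assumes "x \<in> M" "y \<in> M" "(x, y) \<in> strict_rel S"
  shows "d x y > 0"
  using assms zero[of x y] nonneg[of x y] by (auto simp: strict_rel_def less_le)

lemma cond_F1_canonical_fuzzy_metric: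
  "cond_F1 M (canonical_fuzzy_metric d) S ({0<..1} \<times> {0<..1}) T"
  using canonical_fuzzy_metric_pos canonical_fuzzy_metric_in_unit
  unfolding cond_F1_def fuzzy_pairs_def by auto

text \<open>The fuzzy hypothesis holds at all levels, so its instance at level 1 feeds B2; the limit
  of the distances then serves every \<open>t\<close>.\<close>

lemma cond_F2_canonical_fuzzy_metric:
  assumes "cond_B2 M d S \<rho> T"
  shows "cond_F2 M (canonical_fuzzy_metric d) S (theta_of \<rho>) T"
  unfolding cond_F2_def
proof (intro allI impI, elim conjE)
  fix x and t :: real
  assume t: "t > 0" and x: "picard_sequence M T x" "rel_strictly_increasing S x"
    and *: "\<forall>n. \<forall>t>0. theta_of \<rho> (canonical_fuzzy_metric d (x (Suc n)) (x (Suc (Suc n))) t)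
      (canonical_fuzzy_metric d (x n) (x (Suc n)) t) \<ge> 0"
  have "\<rho> (d (x (Suc n)) (x (Suc (Suc n)))) (d (x n) (x (Suc n))) \<ge> 0" for n
    using *[rule_format, of 1 n] by (simp add: theta_of_canonical_fuzzy_metric)
  \<comment> \<open>One strict increase carries the two separate hypotheses of B2: relatedness and
    distinctness of consecutive terms.\<close>
  moreover have "rel_nondecreasing S x" "\<forall>n. x n \<noteq> x (Suc n)"
    using x(2) by (auto simp: rel_strictly_increasing_def rel_nondecreasing_def strict_rel_def)
  ultimately have "(\<lambda>n. d (x n) (x (Suc n))) \<longlonglongrightarrow> 0"
    using assms x(1) unfolding cond_B2_def by blast
  then show "(\<lambda>n. canonical_fuzzy_metric d (x n) (x (Suc n)) t) \<longlonglongrightarrow> 1"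
    by (simp add: canonical_fuzzy_metric_tendsto_1_iff t)
qed

text \<open>For fixed \<open>t\<close>, the map \<open>r \<mapsto> t / (t + r)\<close> is a
  decreasing homeomorphism from \<open>[0, \<infinity>)\<close> onto \<open>(0, 1]\<close>. Common
  limits therefore pass to the distances, and a strict upper bound \<open>L\<close> becomes a strict
  lower bound \<open>l\<close>, as B3 demands.\<close>

lemma cond_F3_canonical_fuzzy_metric:
  assumes T: "T \<in> M \<rightarrow> M"
    and B3: "cond_B3 M d S {0..} \<rho> T"
    and scale: "\<And>t s r. t > 0 \<Longrightarrow> s > 0 \<Longrightarrow> \<rho> t s \<ge> 0 \<Longrightarrow> r > 0 \<Longrightarrow> \<rho> (t / r) (s / r) \<ge> 0"
  shows "cond_F3 M (canonical_fuzzy_metric d) S (theta_of \<rho>) T"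
  unfolding cond_F3_def
proof (intro allI impI, elim conjE)
  fix \<phi> \<psi> and t L :: real
  assume seq: "fuzzy_rel_sequence M (canonical_fuzzy_metric d) S T \<phi> \<psi>"
    and t: "t > 0" and L: "L \<in> {0..1}"
    and lim: "(\<lambda>n. \<phi> n t) \<longlonglongrightarrow> L" "(\<lambda>n. \<psi> n t) \<longlonglongrightarrow> L"
    and *: "\<forall>n. L > \<phi> n t \<and> theta_of \<rho> (\<phi> n t) (\<psi> n t) \<ge> 0"
  obtain x y where xy: "\<And>n. x n \<in> M" "\<And>n. y n \<in> M" "\<And>n. (x n, y n) \<in> strict_rel S"
      "\<And>n. (T (x n), T (y n)) \<in> strict_rel S"
    and eq: "\<And>n. \<phi> n t = canonical_fuzzy_metric d (T (x n)) (T (y n)) t"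
      "\<And>n. \<psi> n t = canonical_fuzzy_metric d (x n) (y n) t"
    using seq t unfolding fuzzy_rel_sequence_def by blast
  \<comment> \<open>For \<open>L > 0\<close> this is the solution of \<open>t / (t + l) = L\<close>,
    hence the limit expected of the distances.\<close>
  define l where "l = t * ((1 - L) / L)"
  have less: "canonical_fuzzy_metric d (T (x n)) (T (y n)) t < L" for n
    using * eq by metis
  \<comment> \<open>Fuzzy values are positive and lie below \<open>L\<close>. This excludes
    \<open>L = 0\<close>, where \<open>l\<close> would be 0 only by the convention for division by
    zero.\<close>
  have "L > 0"
    using less[of 0] canonical_fuzzy_metric_pos[OF t, of "T (x 0)" "T (y 0)"] by linarith
  have "l \<ge> 0"
    using L t unfolding l_def by simp
  have gt: "l < d (T (x n)) (T (y n))" for n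
  proof -
    have "t + d (T (x n)) (T (y n)) > 0"
      using t nonneg[of "T (x n)" "T (y n)"] by linarith
    then show ?thesis
      using less[of n] \<open>L > 0\<close> t by (simp add: canonical_fuzzy_metric_def l_def field_simps)
  qed
  have rho: "\<rho> (d (T (x n)) (T (y n))) (d (x n) (y n)) \<ge> 0" for n
  proof -
    have "d (T (x n)) (T (y n)) > 0" "d (x n) (y n) > 0"
      by (intro dist_pos_strict_rel[of _ _ S] funcset_mem[OF T] xy)+
    moreover have "\<rho> (d (T (x n)) (T (y n)) / t) (d (x n) (y n) / t) \<ge> 0"
      using *[rule_format, of n] by (simp add: eq theta_of_canonical_fuzzy_metric t)
    \<comment> \<open>Scaling by \<open>r = 1 / t\<close> undoes the division by
      \<open>t\<close>.\<close>
    ultimately show ?thesis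
      using t scale[of "d (T (x n)) (T (y n)) / t" "d (x n) (y n) / t" "1 / t"] by simp
  qed
  have "(\<lambda>n. d (T (x n)) (T (y n))) \<longlonglongrightarrow> l" "(\<lambda>n. d (x n) (y n)) \<longlonglongrightarrow> l"
    using lim \<open>L > 0\<close> unfolding l_def eq
    by (intro tendsto_dist_of_canonical_fuzzy_metric[OF t]; simp)+
  moreover have "rel_sequence M d S T (\<lambda>n. d (T (x n)) (T (y n))) (\<lambda>n. d (x n) (y n))"
    unfolding rel_sequence_def using xy by (intro exI[of _ x] exI[of _ y]) simp
  ultimately have "l = 0"
    using B3[unfolded cond_B3_def, rule_format,
        of "\<lambda>n. d (T (x n)) (T (y n))" "\<lambda>n. d (x n) (y n)" l]
      \<open>l \<ge> 0\<close> gt rho by simp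
  \<comment> \<open>With \<open>t\<close> and \<open>L\<close> positive, \<open>l\<close> vanishes
    only if \<open>1 - L\<close> does.\<close>
  then show "L = 1"
    using t \<open>L > 0\<close> by (simp add: l_def)
qed

text \<open>B4 gives the inequality for the distances themselves; scaling by \<open>r = t\<close>
  moves it to level \<open>t\<close>.\<close>

lemma cond_F4_canonical_fuzzy_metric:
  assumes T: "T \<in> M \<rightarrow> M"
    and B4: "cond_B4 M d S \<rho> T"
    and scale: "\<And>t s r. t > 0 \<Longrightarrow> s > 0 \<Longrightarrow> \<rho> t s \<ge> 0 \<Longrightarrow> r > 0 \<Longrightarrow> \<rho> (t / r) (s / r) \<ge> 0"
  shows "cond_F4 M (canonical_fuzzy_metric d) S (theta_of \<rho>) T"
  unfolding cond_F4_def
proof (intro allI impI ballI, elim conjE)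
  fix t :: real and x y
  assume t: "t > 0" and xy: "x \<in> M" "y \<in> M" "(x, y) \<in> strict_rel S" "(T x, T y) \<in> strict_rel S"
  have "d (T x) (T y) > 0" "d x y > 0"
    by (intro dist_pos_strict_rel[of _ _ S] funcset_mem[OF T] xy)+
  then have "\<rho> (d (T x) (T y) / t) (d x y / t) \<ge> 0"
    using B4 xy t unfolding cond_B4_def by (intro scale) auto
  then show "theta_of \<rho> (canonical_fuzzy_metric d (T x) (T y) t) (canonical_fuzzy_metric d x y t) \<ge> 0"
    by (simp add: theta_of_canonical_fuzzy_metric t)
qed

lemma cond_F5_canonical_fuzzy_metric:
  assumes "cond_B5 M d S \<rho> T"
  shows "cond_F5 M (canonical_fuzzy_metric d) S (theta_of \<rho>) T"
  unfolding cond_F5_def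
proof (intro allI impI, elim conjE)
  fix \<phi> \<psi> and t :: real
  assume t: "t > 0" and seq: "fuzzy_rel_sequence M (canonical_fuzzy_metric d) S T \<phi> \<psi>"
    and lim: "\<forall>t>0. (\<lambda>n. \<psi> n t) \<longlonglongrightarrow> 1"
    and *: "\<forall>n. \<forall>t>0. theta_of \<rho> (\<phi> n t) (\<psi> n t) \<ge> 0"
  \<comment> \<open>The equations are kept for all levels: level 1 is used for the hypotheses of B5,
    the fixed \<open>t\<close> for the conclusion.\<close>
  obtain x y where xy: "\<And>n. x n \<in> M \<and> y n \<in> M \<and> (x n, y n) \<in> strict_rel S \<and>
      (T (x n), T (y n)) \<in> strict_rel S"
    and eq: "\<And>n t. t > 0 \<Longrightarrow> \<phi> n t = canonical_fuzzy_metric d (T (x n)) (T (y n)) t"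
      "\<And>n t. t > 0 \<Longrightarrow> \<psi> n t = canonical_fuzzy_metric d (x n) (y n) t"
    using seq unfolding fuzzy_rel_sequence_def by blast
  have "(\<lambda>n. d (x n) (y n)) \<longlonglongrightarrow> 0"
    using lim[rule_format, of 1] by (simp add: eq canonical_fuzzy_metric_tendsto_1_iff)
  moreover have "\<rho> (d (T (x n)) (T (y n))) (d (x n) (y n)) \<ge> 0" for n
    using *[rule_format, of 1 n] by (simp add: eq theta_of_canonical_fuzzy_metric)
  moreover have "rel_sequence M d S T (\<lambda>n. d (T (x n)) (T (y n))) (\<lambda>n. d (x n) (y n))"
    unfolding rel_sequence_def using xy by (intro exI[of _ x] exI[of _ y]) simp
  ultimately have "(\<lambda>n. d (T (x n)) (T (y n))) \<longlonglongrightarrow> 0"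
    using assms[unfolded cond_B5_def, rule_format,
        of "\<lambda>n. d (T (x n)) (T (y n))" "\<lambda>n. d (x n) (y n)"] by simp
  then show "(\<lambda>n. \<phi> n t) \<longlonglongrightarrow> 1"
    by (simp add: eq t canonical_fuzzy_metric_tendsto_1_iff)
qed

text \<open>Level 1 again yields the metric hypothesis. What remains is to match Picard sequences
  with the orbits of their initial points, in terms of which B2' is phrased.\<close>

lemma cond_F2'_canonical_fuzzy_metric:
  assumes "cond_B2' M d S \<rho> T"
  shows "cond_F2' M (canonical_fuzzy_metric d) S (theta_of \<rho>) T"
  unfolding cond_F2'_def
proof (intro allI impI, elim conjE)
  fix x y and t :: real
  assume t: "t > 0" and P: "picard_sequence M T x" "picard_sequence M T y"
    and rel: "\<forall>n. (x n, y n) \<in> strict_rel S"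
    and *: "\<forall>n. \<forall>t>0. theta_of \<rho> (canonical_fuzzy_metric d (x (Suc n)) (y (Suc n)) t)
      (canonical_fuzzy_metric d (x n) (y n) t) \<ge> 0"
  have iter: "(T ^^ n) (z 0) = z n" if "picard_sequence M T z" for z n
    using that by (induction n) (auto simp: picard_sequence_def)
  have "\<rho> (d (x (Suc n)) (y (Suc n))) (d (x n) (y n)) \<ge> 0" for n
    using *[rule_format, of 1 n] by (simp add: theta_of_canonical_fuzzy_metric)
  moreover have "x 0 \<in> M" "y 0 \<in> M"
    using P by (auto simp: picard_sequence_def)
  ultimately have "(\<lambda>n. d (x n) (y n)) \<longlonglongrightarrow> 0"
    using assms[unfolded cond_B2'_def, rule_format, of "x 0" "y 0"] rel
    \<comment> \<open>Using only these equations keeps \<open>T ^^ Suc n\<close> folded, so that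
      \<open>iter\<close> turns it into the term of index \<open>Suc n\<close>.\<close>
    by (simp only: iter[OF P(1)] iter[OF P(2)])
  then show "(\<lambda>n. canonical_fuzzy_metric d (x n) (y n) t) \<longlonglongrightarrow> 1"
    by (simp add: canonical_fuzzy_metric_tendsto_1_iff t)
qed

end

theorem theorem28:
  fixes X :: "'a set" and d :: "'a \<Rightarrow> 'a \<Rightarrow> real" and S :: "('a \<times> 'a) set"
    and \<rho> :: "real \<Rightarrow> real \<Rightarrow> real" and T :: "'a \<Rightarrow> 'a"
  assumes "Metric_space X d"
    and "binary_relation_on X S"
    and "T \<in> X \<rightarrow> X"
    and "ample_spectrum_contraction X d S {0..} \<rho> T"
    and "\<And>t s r. t > 0 \<Longrightarrow> s > 0 \<Longrightarrow> \<rho> t s \<ge> 0 \<Longrightarrow> r > 0 \<Longrightarrow> \<rho> (t / r) (s / r) \<ge> 0"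
  shows "fuzzy_ample_spectrum_contraction X (canonical_fuzzy_metric d) S
           ({0<..1} \<times> {0<..1}) (theta_of \<rho>) T
       \<and> (cond_B5 X d S \<rho> T \<longrightarrow> cond_F5 X (canonical_fuzzy_metric d) S (theta_of \<rho>) T)
       \<and> (cond_B2' X d S \<rho> T \<longrightarrow> cond_F2' X (canonical_fuzzy_metric d) S (theta_of \<rho>) T)"
proof -
  interpret Metric_space X d by fact
  have B: "cond_B2 X d S \<rho> T" "cond_B3 X d S {0..} \<rho> T" "cond_B4 X d S \<rho> T"
    using assms(4) unfolding ample_spectrum_contraction_def by auto
  show ?thesis
    unfolding fuzzy_ample_spectrum_contraction_def
    using cond_F1_canonical_fuzzy_metric cond_F2_canonical_fuzzy_metric[OF B(1)]
      cond_F3_canonical_fuzzy_metric[OF assms(3) B(2) assms(5)]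
      cond_F4_canonical_fuzzy_metric[OF assms(3) B(3) assms(5)]
      cond_F5_canonical_fuzzy_metric cond_F2'_canonical_fuzzy_metric
    by blast
qed

end
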